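(* Let $K$ be a disk of radius $h$ centered at the origin, and consider the $p\times p$ mass matrix $M$ with entries $M_{m,\ell}=\int_{\partial K}\varphi_m\overline{\varphi_\ell}\,ds$ resulting from $p$ evenly spaced plane waves. Then the following hold, where $\lambda_L(M)$, $L=0,\dots,p-1$, denote the eigenvalues of the circulant matrix $M$: (1) The generating function for $M$ is $F_M(x)=2\pi h\,J_0\!\left(2\kappa h\sin\left(\frac{x}{2}\right)\right)$. (2) There is a simple eigenvalue of $M$ given by $$\lambda_0(M)=\sum_{j=0}^{p-1}F_M\!\left(\tfrac{2j}{p}\pi\right)\approx ph\int_0^{2\pi}J_0(2\kappa h\sin(x))\,dx .$$ (3) The multiplicity-two eigenvalues of $M$ are given by $$\lambda_L(M)=\sum_{j=0}^{p-1}F_M\!\left(\tfrac{2j}{p}\pi\right)e^{-i\frac{2j}{p}L\pi}\approx hp\int_0^{2\pi}J_{2L}(2\kappa h\sin(t))\,dt,\qquad L=1,\dots,\left\lfloor\tfrac{p-1}{2}\right\rfloor .$$ (4) If $p$ is even, there is an additional simple eigenvalue $$\lambda_{p/2}(M)=\sum_{j=0}^{p-1}(-1)^jF_M\!\left(\tfrac{2j}{p}\pi\right)\approx hp\int_0^{2\pi}J_p(2\kappa h\sin(t))\,dt .$$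
   Context: Plane waves: $\varphi_m(\mathbf x)=e^{i\kappa\,\mathbf d_m\cdot\mathbf x}$ for $\mathbf x\in\mathbb R^2$, where $\kappa$ is the real wave number and $\mathbf d_m=(\cos\theta_m,\sin\theta_m)$, $\theta_m=2\pi m/p$, $m=0,\dots,p-1$. $ds$ is arclength and $J_n$ is the Bessel function of the first kind of integer order $n$. A $p\times p$ circulant matrix $C=\mathrm{circ}[c_0,\dots,c_{p-1}]$ is one whose first row is $c_0,\dots,c_{p-1}$ and in which each row is the right cyclic shift of the row above. Its eigenvalues are $\lambda_L(C)=\sum_{j=0}^{p-1}c_je^{-2\pi ijL/p}$, $L=0,\dots,p-1$. A function $f$ on $[0,2\pi]$ is the generating function of $C$ if $c_j=f(2\pi j/p)$ for all $j$. The symbol $\approx$ denotes approximation by the trapezoidal rule, $\sum_{j=0}^{p-1}F(2\pi j/p)e^{-2\pi ijL/p}\approx\frac{p}{2\pi}\int_0^{2\pi}F(x)e^{-iLx}\,dx$; no error bound is part of the statement.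
   Formalization: Exact multiplicities 1, 2, 1 are claimed only when λ_0,…,λ_⌊p/2⌋ are distinct (for p=2 and J_0(2κh)=0, λ_0=λ_1); this fails for only finitely many κ in each bounded interval, and the eigenvalue list with multiplicity is given for all κ. *)

theory Defs
  imports "HOL-Analysis.Analysis" "Jordan_Normal_Form.Char_Poly"
begin

text \<open>The plane is the type \<open>real \<times> real\<close>, whose library norm and inner product are the Euclidean
  ones.\<close>

definition theta :: "nat \<Rightarrow> nat \<Rightarrow> real" where
  "theta p m = 2 * pi * real m / real p"

definition wave_dir :: "nat \<Rightarrow> nat \<Rightarrow> real \<times> real" where
  "wave_dir p m = (cos (theta p m), sin (theta p m))"

definition plane_wave :: "real \<Rightarrow> nat \<Rightarrow> nat \<Rightarrow> real \<times> real \<Rightarrow> complex" where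
  "plane_wave \<kappa> p m x = exp (\<i> * complex_of_real (\<kappa> * inner (wave_dir p m) x))"

text \<open>The integral \<open>\<integral> f ds\<close> with respect to arclength along a curve parametrised by \<open>[0,1]\<close>.\<close>

definition arclength_integral ::
    "(real \<Rightarrow> real \<times> real) \<Rightarrow> (real \<times> real \<Rightarrow> complex) \<Rightarrow> complex" where
  "arclength_integral \<gamma> f =
     integral {0..1} (\<lambda>t. norm (vector_derivative \<gamma> (at t within {0..1})) *\<^sub>R f (\<gamma> t))"

definition circle_curve :: "real \<Rightarrow> real \<Rightarrow> real \<times> real" where
  "circle_curve h t = (h * cos (2 * pi * t), h * sin (2 * pi * t))"

text \<open>The curve runs exactly once through the boundary of the disk of radius \<open>h\<close> about the origin.\<close>

lemma circle_curve_boundary: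
  assumes "h > 0"
  shows "path_image (circle_curve h) = frontier (cball 0 h)"
    and "simple_path (circle_curve h)"
    and "pathfinish (circle_curve h) = pathstart (circle_curve h)"
proof -
  have cont: "path (circle_curve h)"
    unfolding path_def circle_curve_def by (intro continuous_intros)
  have "s = t \<or> s = 0 \<and> t = 1 \<or> s = 1 \<and> t = 0"
    if st: "s \<in> {0..1}" "t \<in> {0..1}" and eq: "circle_curve h s = circle_curve h t" for s t
  proof -
    have "sin (2 * pi * s) = sin (2 * pi * t) \<and> cos (2 * pi * s) = cos (2 * pi * t)"
      using eq assms by (simp add: circle_curve_def)
    then obtain n :: int where "2 * pi * s = 2 * pi * t + 2 * pi * n"
      using sin_cos_eq_iff by blast
    then have "2 * pi * s = 2 * pi * (t + n)"
      by (simp add: distrib_left)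
    then have n: "s = t + n"
      by simp
    with st have "real_of_int n \<le> 1" "- 1 \<le> real_of_int n"
      by auto
    then have "n = - 1 \<or> n = 0 \<or> n = 1"
      by linarith
    with n st show ?thesis
      by auto
  qed
  with cont show "simple_path (circle_curve h)"
    unfolding simple_path_def loop_free_def by blast
  show "pathfinish (circle_curve h) = pathstart (circle_curve h)"
    by (simp add: circle_curve_def pathfinish_def pathstart_def)
  have "y \<in> circle_curve h ` {0..1}" if y: "y \<in> sphere 0 h" for y
  proof -
    have n: "(fst y)\<^sup>2 + (snd y)\<^sup>2 = h\<^sup>2"
      using y assms by (auto simp: norm_prod_def)
    have "(fst y / h)\<^sup>2 + (snd y / h)\<^sup>2 = 1"
      using n assms by (simp add: power_divide flip: add_divide_distrib)
    then obtain t where t: "0 \<le> t" "t < 2 * pi" "fst y / h = cos t" "snd y / h = sin t"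
      using sincos_total_2pi by blast
    have "y = circle_curve h (t / (2 * pi))"
      using t(3,4) assms by (auto simp: circle_curve_def prod_eq_iff field_simps)
    moreover have "t / (2 * pi) \<in> {0..1}"
      using t(1,2) by simp
    ultimately show ?thesis by blast
  qed
  moreover have "circle_curve h t \<in> sphere 0 h" for t
    using assms
    by (simp add: circle_curve_def norm_prod_def power_mult_distrib flip: distrib_left)
  ultimately have "circle_curve h ` {0..1} = sphere 0 h"
    by blast
  then show "path_image (circle_curve h) = frontier (cball 0 h)"
    using assms by (simp add: path_image_def)
qed

definition mass_matrix :: "real \<Rightarrow> real \<Rightarrow> nat \<Rightarrow> complex mat" where
  "mass_matrix \<kappa> h p = mat p p (\<lambda>(m, l).
     arclength_integral (circle_curve h) (\<lambda>x. plane_wave \<kappa> p m x * cnj (plane_wave \<kappa> p l x)))"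

text \<open>The Bessel function of the first kind of integer order \<open>n \<ge> 0\<close>, by its power series.\<close>

definition Bessel_J :: "nat \<Rightarrow> real \<Rightarrow> real" where
  "Bessel_J n x = (\<Sum>k. (- 1) ^ k / (fact k * fact (k + n)) * (x / 2) ^ (2 * k + n))"

definition F_M :: "real \<Rightarrow> real \<Rightarrow> real \<Rightarrow> real" where
  "F_M \<kappa> h x = 2 * pi * h * Bessel_J 0 (2 * \<kappa> * h * sin (x / 2))"

text \<open>\<open>circ p c\<close> has first row \<open>c 0, \<dots>, c (p - 1)\<close>, and each further row is the right cyclic shift
  of the one above. The summand \<open>p\<close> keeps the natural-number subtraction from truncating.\<close>

definition circ :: "nat \<Rightarrow> (nat \<Rightarrow> complex) \<Rightarrow> complex mat" where
  "circ p c = mat p p (\<lambda>(i, j). c ((j + p - i) mod p))"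

definition generating_function :: "(real \<Rightarrow> complex) \<Rightarrow> complex mat \<Rightarrow> bool" where
  "generating_function f C \<longleftrightarrow>
     C = circ (dim_row C) (\<lambda>j. f (2 * pi * real j / real (dim_row C)))"

text \<open>The value \<open>\<lambda>\<^sub>L(C)\<close> attached to a circulant matrix, in terms of its first row.\<close>

definition circ_eigenvalue :: "complex mat \<Rightarrow> nat \<Rightarrow> complex" where
  "circ_eigenvalue C L =
     (\<Sum>j<dim_row C. C $$ (0, j) * exp (- (2 * pi * \<i> * of_nat j * of_nat L / of_nat (dim_row C))))"

text \<open>\<open>S \<approx> I\<close> in the sense of the trapezoidal rule: \<open>S\<close> is the \<open>p\<close>-point trapezoidal sum of
  \<open>F x * exp (- \<i> L x)\<close> over a period and \<open>I\<close> is exactly the scaled integral this sum approximates.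
  No error bound is involved.\<close>

definition trapezoidal_approx :: "nat \<Rightarrow> (real \<Rightarrow> complex) \<Rightarrow> nat \<Rightarrow> complex \<Rightarrow> complex \<Rightarrow> bool" where
  "trapezoidal_approx p F L S I \<longleftrightarrow>
     S = (\<Sum>j<p. F (2 * pi * real j / real p)
            * exp (- (2 * pi * \<i> * of_nat j * of_nat L / of_nat p))) \<and>
     (\<lambda>x. F x * exp (- (\<i> * of_nat L * of_real x))) integrable_on {0..2 * pi} \<and>
     I = of_nat p / (2 * of_real pi)
           * integral {0..2 * pi} (\<lambda>x. F x * exp (- (\<i> * of_nat L * of_real x)))"

text \<open>Algebraic multiplicity of \<open>z\<close> as an eigenvalue of \<open>A\<close>; \<open>order\<close> alone would be ambiguous with
  the order of a group.\<close>

definition alg_multiplicity :: "complex mat \<Rightarrow> complex \<Rightarrow> nat" where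
  "alg_multiplicity A z = Polynomial.order z (char_poly A)"

text \<open>The eigenvalues \<open>\<lambda>\<^sub>L\<close> with \<open>0 \<le> L \<le> p / 2\<close>, one for each pair \<open>{L, p - L}\<close> of indices mod \<open>p\<close>,
  do not coincide accidentally. The eigenvalue curves do cross: for \<open>p = 2\<close> one has
  \<open>\<lambda>\<^sub>0 = \<lambda>\<^sub>1\<close> at every zero of \<open>J\<^sub>0(2 \<kappa> h)\<close>, so simplicity can fail for isolated \<open>\<kappa>\<close>.\<close>

definition no_coincidence :: "real \<Rightarrow> real \<Rightarrow> nat \<Rightarrow> bool" where
  "no_coincidence \<kappa> h p \<longleftrightarrow> inj_on (circ_eigenvalue (mass_matrix \<kappa> h p)) {0..p div 2}"

end

theory Submission
  imports Defs "HOL-Complex_Analysis.Complex_Analysis"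
begin

text \<open>Write \<open>\<delta>\<close> for the angle between two of the directions. The phase difference of the two
  plane waves on the circle is \<open>2 \<kappa> h sin (\<delta> / 2) sin (\<tau> - a)\<close>, a single sine in the polar angle
  \<open>\<tau>\<close>, so the matrix entry is \<open>2 \<pi> h J\<^sub>0(2 \<kappa> h sin (\<delta> / 2))\<close>, an even \<open>2 \<pi>\<close>-periodic function of
  \<open>\<delta>\<close>. The discrete Fourier matrix diagonalises a circulant matrix, and evenness pairs the
  eigenvalues of \<open>L\<close> and \<open>p - L\<close>. All integrals are evaluated by integrating the power series
  termwise, after expanding \<open>sin\<^sup>n\<close> into exponentials; the scaled Fourier coefficient of \<open>J\<^sub>0\<close> and
  the integral of \<open>J\<^bsub>2L\<^esub>\<close> then agree term by term.

  The discrete analogue of the same expansion rules out identical coincidences: for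
  \<open>L < L' \<le> p / 2\<close>, the difference \<open>\<lambda>\<^sub>L - \<lambda>\<^bsub>L'\<^esub>\<close> is an entire function of \<open>\<kappa>\<^sup>2\<close> whose coefficient
  of index \<open>L\<close> does not vanish, hence its zeros are isolated.\<close>

section \<open>Bessel integrals\<close>

text \<open>The Weierstrass M-test makes the partial sums converge uniformly, and uniform limits
  commute with the integral. All termwise integrations below go through this form.\<close>

lemma has_integral_sums:
  fixes f :: "nat \<Rightarrow> real \<Rightarrow> 'a :: banach"
  assumes int: "\<And>k. (f k has_integral I k) {a..b}"
    and cont: "\<And>k. continuous_on {a..b} (f k)"
    and bound: "\<And>k x. x \<in> {a..b} \<Longrightarrow> norm (f k x) \<le> M k"
    and M: "summable M"
    and sums: "\<And>x. x \<in> {a..b} \<Longrightarrow> (\<lambda>k. f k x) sums g x"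
  shows "g integrable_on {a..b}" and "I sums integral {a..b} g"
proof -
  have "uniform_limit {a..b} (\<lambda>n x. \<Sum>k<n. f k x) (\<lambda>x. suminf (\<lambda>k. f k x)) sequentially"
    by (rule Weierstrass_m_test[OF bound M])
  then have lim: "uniform_limit {a..b} (\<lambda>n x. \<Sum>k<n. f k x) g sequentially"
    by (rule uniform_limit_cong'[THEN iffD1, rotated 2]) (auto simp: sums_unique[OF sums])
  obtain S J where S: "\<And>n. ((\<lambda>x. \<Sum>k<n. f k x) has_integral S n) {a..b}"
      and J: "(g has_integral J) {a..b}" and SJ: "S \<longlonglongrightarrow> J"
    by (rule uniform_limit_integral[OF lim])
      (auto intro: continuous_on_sum cont)
  have "S n = (\<Sum>k<n. I k)" for n
    by (rule has_integral_unique[OF S]) (intro has_integral_sum int, simp)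
  then have "S = (\<lambda>n. \<Sum>k<n. I k)" by blast
  with SJ J show "I sums integral {a..b} g" "g integrable_on {a..b}"
    by (auto simp: sums_def integral_unique)
qed

section \<open>Powers of the sine integrated over a period\<close>

text \<open>Orthogonality of exponentials. The frequency \<open>w\<close> stays general because both
  the period 1 of the curve parameter and the period 2 pi of the angle occur.\<close>

lemma has_integral_exp_period:
  assumes b: "b > 0" and w: "w * b = 2 * pi"
  shows "((\<lambda>x. exp (\<i> * of_int m * of_real (w * x))) has_integral (if m = 0 then of_real b else 0)) {0..b}"
proof (cases "m = 0")
  case True
  have "((\<lambda>x. 1 :: complex) has_integral of_real b) {0..b}"
    using has_integral_const_real[of "1::complex" 0 b] b by (simp add: scaleR_conv_of_real)
  with True show ?thesis by simp
next
  case False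
  define c where "c = \<i> * of_int m * of_real w"
  have "w \<noteq> 0" using w by auto
  then have c: "c \<noteq> 0" using False by (simp add: c_def)
  have "((\<lambda>x. exp (c * of_real x)) has_integral exp (c * of_real b) / c - exp (c * of_real 0) / c) {0..b}"
  proof (rule fundamental_theorem_of_calculus)
    fix x :: real
    have "((\<lambda>z. exp (c * z) / c) has_field_derivative exp (c * of_real x)) (at (of_real x))"
      using c by (auto intro!: derivative_eq_intros)
    then show "((\<lambda>x. exp (c * of_real x) / c) has_vector_derivative exp (c * of_real x)) (at x within {0..b})"
      using has_vector_derivative_real_field has_vector_derivative_at_within by blast
  qed (use b in simp)
  moreover have "c * of_real b = 2 * of_int m * of_real pi * \<i>"
    using arg_cong[OF w, of complex_of_real] by (simp add: c_def algebra_simps)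
  then have "exp (c * of_real b) = 1"
    using exp_integer_2pi[of "of_int m"] by (simp add: mult.assoc)
  ultimately show ?thesis using False by (simp add: c_def algebra_simps)
qed

text \<open>Binomial theorem for ((e^(ix) - e^(-ix)) / (2i))^n; \<open>m\<close> counts the factors
  -e^(-ix), so the frequency is n - 2m.\<close>

lemma sin_power_exp:
  "of_real (sin x) ^ n =
     (\<Sum>m\<le>n. of_nat (n choose m) * (- 1) ^ m / (2 * \<i>) ^ n * exp (\<i> * of_int (int n - 2 * int m) * of_real x))"
proof -
  have "complex_of_real (sin x) = (- exp (- \<i> * of_real x) + exp (\<i> * of_real x)) / (2 * \<i>)"
    unfolding sin_of_real[symmetric] sin_exp_eq by simp
  then have "of_real (sin x) ^ n = (- exp (- \<i> * of_real x) + exp (\<i> * of_real x)) ^ n / (2 * \<i>) ^ n"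
    by (simp only: power_divide)
  also have "\<dots> = (\<Sum>m\<le>n. of_nat (n choose m) * (- exp (- \<i> * of_real x)) ^ m
                     * exp (\<i> * of_real x) ^ (n - m) / (2 * \<i>) ^ n)"
    by (simp only: binomial_ring sum_divide_distrib)
  also have "\<dots> = (\<Sum>m\<le>n. of_nat (n choose m) * (- 1) ^ m / (2 * \<i>) ^ n
                     * exp (\<i> * of_int (int n - 2 * int m) * of_real x))"
  proof (rule sum.cong[OF refl])
    fix m assume "m \<in> {..n}"
    then have "(- exp (- \<i> * of_real x)) ^ m * exp (\<i> * of_real x) ^ (n - m)
        = (- 1) ^ m * exp (\<i> * of_int (int n - 2 * int m) * of_real x)"
      by (subst power_minus)
        (simp add: exp_of_nat_mult[symmetric] exp_add[symmetric] of_nat_diff algebra_simps)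
    then show "of_nat (n choose m) * (- exp (- \<i> * of_real x)) ^ m * exp (\<i> * of_real x) ^ (n - m) / (2 * \<i>) ^ n
       = of_nat (n choose m) * (- 1) ^ m / (2 * \<i>) ^ n * exp (\<i> * of_int (int n - 2 * int m) * of_real x)"
      by simp
  qed
  finally show ?thesis .
qed

lemma imaginary_even_power: "(\<i> * z) ^ (2 * k) = (- 1) ^ k * z ^ (2 * k)"
proof -
  have "(\<i> * z) ^ (2 * k) = (\<i> ^ 2) ^ k * z ^ (2 * k)"
    by (simp only: power_mult_distrib power_mult)
  then show ?thesis by simp
qed

lemma two_imaginary_even_power: "(2 * \<i>) ^ (2 * k) = (- 1) ^ k * 4 ^ k"
proof -
  have "(2 :: complex) ^ (2 * k) = 4 ^ k"
    by (simp only: power_mult) simp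
  then show ?thesis using imaginary_even_power[of 2 k] by (simp only: mult.commute)
qed

text \<open>Halving the angle turns the even frequencies 2k - 2m into k - m, so every integer mode
  of a 2 pi-periodic function can occur. Both the integral and the discrete Fourier coefficients
  start from this expansion.\<close>

lemma sin_half_even_power_exp:
  "of_real (sin (x / 2)) ^ (2 * k) =
     (\<Sum>m\<le>2 * k. of_nat (2 * k choose m) * (- 1) ^ (m + k) / 4 ^ k * exp (\<i> * of_int (int k - int m) * of_real x))"
  unfolding sin_power_exp
proof (rule sum.cong[OF refl])
  fix m
  have "\<i> * of_int (int (2 * k) - 2 * int m) * of_real (x / 2) = \<i> * of_int (int k - int m) * of_real x"
    by simp
  moreover have "(- 1 :: complex) ^ m / ((- 1) ^ k * 4 ^ k) = (- 1) ^ (m + k) / 4 ^ k"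
    by (simp add: power_add divide_simps minus_one_mult_self)
  ultimately show "of_nat (2 * k choose m) * (- 1) ^ m / (2 * \<i>) ^ (2 * k)
        * exp (\<i> * of_int (int (2 * k) - 2 * int m) * of_real (x / 2))
      = of_nat (2 * k choose m) * (- 1) ^ (m + k) / 4 ^ k * exp (\<i> * of_int (int k - int m) * of_real x)"
    unfolding two_imaginary_even_power by (simp only: times_divide_eq_right[symmetric])
qed

text \<open>Only the mode of frequency 0 survives, that is m = n / 2, which exists for even
  \<open>n\<close>. The shift \<open>a\<close> multiplies each mode by a phase that equals 1 at
  frequency 0.\<close>

lemma has_integral_sin_power:
  assumes b: "b > 0" and w: "w * b = 2 * pi"
  shows "((\<lambda>x. of_real (sin (w * x - a)) ^ n) has_integral
           (if even n then of_real b * of_nat (n choose (n div 2)) / 2 ^ n else 0 :: complex)) {0..b}"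
proof -
  define C where "C m = of_nat (n choose m) * (- 1) ^ m / (2 * \<i>) ^ n
    * exp (- \<i> * of_int (int n - 2 * int m) * of_real a)" for m
  have eq: "of_real (sin (w * x - a)) ^ n =
      (\<Sum>m\<le>n. C m * exp (\<i> * of_int (int n - 2 * int m) * of_real (w * x)))" for x
    unfolding sin_power_exp C_def mult.assoc exp_add[symmetric]
    by (intro sum.cong refl) (simp add: algebra_simps)
  have "((\<lambda>x. \<Sum>m\<le>n. C m * exp (\<i> * of_int (int n - 2 * int m) * of_real (w * x))) has_integral
      (\<Sum>m\<le>n. C m * (if int n - 2 * int m = 0 then of_real b else 0))) {0..b}"
    by (intro has_integral_sum has_integral_mult_right has_integral_exp_period[OF b w]) simp
  moreover have "(\<Sum>m\<le>n. C m * (if int n - 2 * int m = 0 then of_real b else 0)) =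
      (if even n then of_real b * of_nat (n choose (n div 2)) / 2 ^ n else 0)"
  proof (cases "even n")
    case True
    then obtain k where n: "n = 2 * k" by blast
    have "(\<Sum>m\<le>n. C m * (if int n - 2 * int m = 0 then of_real b else 0)) =
        (\<Sum>m\<le>n. if m = k then C k * of_real b else 0)"
      by (intro sum.cong) (auto simp: n)
    also have "\<dots> = C k * of_real b" by (simp add: n)
    also have "C k = of_nat (2 * k choose k) / 4 ^ k"
      unfolding C_def n two_imaginary_even_power by simp
    finally show ?thesis by (simp add: n power_mult)
  next
    case False
    then have "int n - 2 * int m \<noteq> 0" for m by presburger
    with False show ?thesis by simp
  qed
  ultimately show ?thesis unfolding eq by simp
qed

text \<open>The factor e^(-iLx) moves the frequencies to k - m - L, so the surviving index is m = k
  - L, which is available only when L \<le> k.\<close>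

lemma has_integral_sin_half_even_power:
  "((\<lambda>x. of_real (sin (x / 2)) ^ (2 * k) * exp (- (\<i> * of_nat L * of_real x))) has_integral
     (if L \<le> k then 2 * of_real pi * (- 1) ^ L * of_nat (2 * k choose (k - L)) / 4 ^ k else 0 :: complex)) {0..2 * pi}"
proof -
  define C where "C m = (of_nat (2 * k choose m) * (- 1) ^ (m + k) / 4 ^ k :: complex)" for m
  have eq: "of_real (sin (x / 2)) ^ (2 * k) * exp (- (\<i> * of_nat L * of_real x)) =
      (\<Sum>m\<le>2 * k. C m * exp (\<i> * of_int (int k - int m - int L) * of_real (1 * x)))" for x
    unfolding sin_half_even_power_exp sum_distrib_right C_def mult.assoc exp_add[symmetric]
    by (intro sum.cong refl) (simp add: algebra_simps)
  have "((\<lambda>x. \<Sum>m\<le>2 * k. C m * exp (\<i> * of_int (int k - int m - int L) * of_real (1 * x))) has_integral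
      (\<Sum>m\<le>2 * k. C m * (if int k - int m - int L = 0 then of_real (2 * pi) else 0))) {0..2 * pi}"
    by (intro has_integral_sum has_integral_mult_right has_integral_exp_period) auto
  moreover have "(\<Sum>m\<le>2 * k. C m * (if int k - int m - int L = 0 then of_real (2 * pi) else 0)) =
      (if L \<le> k then 2 * of_real pi * (- 1) ^ L * of_nat (2 * k choose (k - L)) / 4 ^ k else 0)"
  proof (cases "L \<le> k")
    case True
    have "(\<Sum>m\<le>2 * k. C m * (if int k - int m - int L = 0 then of_real (2 * pi) else 0)) =
        (\<Sum>m\<le>2 * k. if m = k - L then C (k - L) * of_real (2 * pi) else 0)"
      using True by (intro sum.cong) (auto simp: of_nat_diff)
    also have "\<dots> = C (k - L) * of_real (2 * pi)" using True by simp
    also have "(- 1 :: complex) ^ (k - L + k) = (- 1) ^ L"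
      using True by (simp add: minus_one_power_iff)
    then have "C (k - L) = (- 1) ^ L * of_nat (2 * k choose (k - L)) / 4 ^ k"
      by (simp add: C_def)
    finally show ?thesis using True by simp
  qed (auto intro!: sum.neutral)
  ultimately show ?thesis unfolding eq by simp
qed

section \<open>Power series of the Bessel functions\<close>

definition Bessel_term :: "nat \<Rightarrow> nat \<Rightarrow> real \<Rightarrow> real" where
  "Bessel_term n k x = (- 1) ^ k / (fact k * fact (k + n)) * (x / 2) ^ (2 * k + n)"

text \<open>A majorant on [-r, r]: estimating the second factorial by 1 leaves a multiple of the
  exponential series at (r/2)^2.\<close>

definition Bessel_bound :: "nat \<Rightarrow> real \<Rightarrow> nat \<Rightarrow> real" where
  "Bessel_bound n r k = (r / 2) ^ n * (((r / 2)\<^sup>2) ^ k / fact k)"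

lemma summable_Bessel_bound: "summable (Bessel_bound n r)"
  unfolding Bessel_bound_def
  by (intro summable_mult) (use summable_exp[of "(r / 2)\<^sup>2"] in \<open>simp add: field_simps\<close>)

lemma Bessel_term_le:
  assumes "\<bar>x\<bar> \<le> r"
  shows "\<bar>Bessel_term n k x\<bar> \<le> Bessel_bound n r k"
proof -
  have "\<bar>Bessel_term n k x\<bar> = (\<bar>x\<bar> / 2) ^ (2 * k + n) / (fact k * fact (k + n))"
    by (simp add: Bessel_term_def abs_mult power_abs)
  also have "\<dots> \<le> (r / 2) ^ (2 * k + n) / (fact k * 1)"
    using assms by (intro frac_le power_mono mult_left_mono fact_ge_1 zero_le_power) auto
  also have "\<dots> = Bessel_bound n r k"
    by (simp add: Bessel_bound_def power_add power_mult)
  finally show ?thesis .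
qed

lemma Bessel_J_sums: "(\<lambda>k. Bessel_term n k x) sums Bessel_J n x"
proof -
  have "summable (\<lambda>k. Bessel_term n k x)"
    by (rule summable_comparison_test'[OF summable_Bessel_bound[of n "\<bar>x\<bar>"]])
      (simp add: Bessel_term_le)
  then show ?thesis
    unfolding Bessel_J_def Bessel_term_def[symmetric] by (rule summable_sums)
qed

lemma continuous_on_Bessel_term [continuous_intros]:
  "continuous_on S f \<Longrightarrow> continuous_on S (\<lambda>x. Bessel_term n k (f x))"
  unfolding Bessel_term_def by (intro continuous_intros) auto

lemma Bessel_J_0_minus: "Bessel_J 0 (- x) = Bessel_J 0 x"
  by (simp add: Bessel_J_def)

lemma even_binomial_fact: "of_nat (2 * k choose k) = (fact (2 * k) / (fact k * fact k) :: 'a :: field_char_0)"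
  by (subst binomial_fact) auto

text \<open>With N = k + L both sides equal (-1)^k (2N)! / (N!^2 k! (k + 2L)!) (z/2)^(2N): the two
  pairs of factorials trade places. This is why the Fourier coefficients of J_0 become integrals of
  J_(2L).\<close>

lemma Bessel_term_shift:
  "Bessel_term 0 (k + L) z * ((- 1) ^ L * of_nat (2 * (k + L) choose k)) =
     Bessel_term (2 * L) k z * of_nat (2 * (k + L) choose (k + L))"
proof -
  have "of_nat (2 * (k + L) choose k) = (fact (2 * (k + L)) / (fact k * fact (k + 2 * L)) :: real)"
    by (subst binomial_fact) (auto intro!: arg_cong[where f = fact])
  moreover have "(- 1 :: real) ^ (k + L) * (- 1) ^ L = (- 1) ^ k"
    by (simp add: power_add)
  moreover have "2 * k + 2 * L = 2 * (k + L)" by simp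
  ultimately show ?thesis
    unfolding Bessel_term_def even_binomial_fact
    by (simp del: distrib_left_numeral add: divide_simps)
qed

section \<open>Integrals producing and containing Bessel functions\<close>

text \<open>Expand the exponential in powers of the sine. Odd powers integrate to 0, and the central
  binomial coefficients from the even ones turn 1/(2k)! into 1/(k!)^2, the coefficients of
  J_0.\<close>

lemma Bessel_J_0_integral:
  assumes b: "b > 0" and w: "w * b = 2 * pi"
  shows "integral {0..b} (\<lambda>t. exp (\<i> * of_real (z * sin (w * t - a)))) = of_real (b * Bessel_J 0 z)"
proof -
  define c where "c n = (\<i> * of_real z) ^ n / fact n" for n
  define I where "I n = (if even n then of_real b * of_nat (n choose (n div 2)) / 2 ^ n else 0 :: complex)" for n
  have "(\<lambda>n. c n * I n) sums integral {0..b} (\<lambda>t. exp (\<i> * of_real (z * sin (w * t - a))))"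
  proof (rule has_integral_sums)
    show "((\<lambda>t. c n * of_real (sin (w * t - a)) ^ n) has_integral c n * I n) {0..b}" for n
      unfolding I_def by (intro has_integral_mult_right has_integral_sin_power[OF b w])
    show "continuous_on {0..b} (\<lambda>t. c n * of_real (sin (w * t - a)) ^ n)" for n
      by (intro continuous_intros)
    show "norm (c n * of_real (sin (w * t - a)) ^ n) \<le> \<bar>z\<bar> ^ n / fact n" for n t
    proof -
      have "\<bar>sin (w * t - a)\<bar> ^ n \<le> 1" by (intro power_le_one) auto
      then show ?thesis
        by (simp add: c_def norm_mult norm_divide norm_power mult_left_le divide_right_mono)
    qed
    show "summable (\<lambda>n. \<bar>z\<bar> ^ n / fact n)"
      using summable_exp[of "\<bar>z\<bar>"] by (simp add: field_simps)
    show "(\<lambda>n. c n * of_real (sin (w * t - a)) ^ n) sums exp (\<i> * of_real (z * sin (w * t - a)))" for t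
      using exp_converges[of "\<i> * of_real (z * sin (w * t - a))"]
      by (simp add: c_def scaleR_conv_of_real power_mult_distrib field_simps)
  qed
  \<comment> \<open>\<open>I\<close> vanishes at odd indices, so reindexing along the even numbers
    keeps the sum.\<close>
  then have "(\<lambda>k. c (2 * k) * I (2 * k)) sums integral {0..b} (\<lambda>t. exp (\<i> * of_real (z * sin (w * t - a))))"
    by (subst sums_mono_reindex) (auto simp: strict_mono_def I_def elim!: evenE)
  moreover have "c (2 * k) * I (2 * k) = of_real (b * Bessel_term 0 k z)" for k
  proof -
    have "(\<i> * of_real z) ^ (2 * k) = of_real ((- 1) ^ k * z ^ (2 * k))"
      by (simp add: imaginary_even_power)
    moreover have "(2 :: complex) ^ (2 * k) = 2 ^ k * 2 ^ k"
      by (simp add: mult_2 power_add)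
    ultimately show ?thesis
      unfolding c_def I_def by (simp add: even_binomial_fact Bessel_term_def power_divide)
  qed
  ultimately have "(\<lambda>k. complex_of_real (b * Bessel_term 0 k z)) sums
      integral {0..b} (\<lambda>t. exp (\<i> * of_real (z * sin (w * t - a))))"
    by simp
  moreover have "(\<lambda>k. complex_of_real (b * Bessel_term 0 k z)) sums of_real (b * Bessel_J 0 z)"
    by (intro sums_of_real sums_mult Bessel_J_sums)
  ultimately show ?thesis by (rule sums_unique2)
qed

text \<open>Both integrals are computed as series; after an index shift by \<open>L\<close> on the
  Fourier side, \<open>Bessel_term_shift\<close> identifies them term by term.\<close>

lemma integral_Bessel_J_fourier:
  shows "(\<lambda>x. of_real (Bessel_J 0 (z * sin (x / 2))) * exp (- (\<i> * of_nat L * of_real x)))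
           integrable_on {0..2 * pi}" (is ?int)
    and "integral {0..2 * pi} (\<lambda>x. of_real (Bessel_J 0 (z * sin (x / 2))) * exp (- (\<i> * of_nat L * of_real x)))
         = complex_of_real (integral {0..2 * pi} (\<lambda>t. Bessel_J (2 * L) (z * sin t)))" (is ?eq)
proof -
  let ?g = "\<lambda>x. of_real (Bessel_J 0 (z * sin (x / 2))) * exp (- (\<i> * of_nat L * of_real x))"
  have sin_le: "\<bar>z * sin u\<bar> \<le> \<bar>z\<bar>" for u
    by (simp add: abs_mult mult_left_le)
  define I where "I k = (if L \<le> k then 2 * of_real pi * (- 1) ^ L * of_nat (2 * k choose (k - L)) / 4 ^ k
    else 0 :: complex)" for k
  define c where "c k = complex_of_real (Bessel_term 0 k z)" for k
  have term_eq: "of_real (Bessel_term 0 k (z * sin (x / 2))) * exp (- (\<i> * of_nat L * of_real x)) =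
      c k * (of_real (sin (x / 2)) ^ (2 * k) * exp (- (\<i> * of_nat L * of_real x)))" for k x
    by (simp add: c_def Bessel_term_def power_mult_distrib power_divide)
  have int: "((\<lambda>x. of_real (Bessel_term 0 k (z * sin (x / 2))) * exp (- (\<i> * of_nat L * of_real x)))
      has_integral c k * I k) {0..2 * pi}" for k
    unfolding term_eq I_def by (intro has_integral_mult_right has_integral_sin_half_even_power)
  have cont: "continuous_on {0..2 * pi}
      (\<lambda>x. complex_of_real (Bessel_term 0 k (z * sin (x / 2))) * exp (- (\<i> * of_nat L * of_real x)))" for k
    by (intro continuous_intros) auto
  have bound: "norm (complex_of_real (Bessel_term 0 k (z * sin (x / 2))) * exp (- (\<i> * of_nat L * of_real x)))
      \<le> Bessel_bound 0 \<bar>z\<bar> k" for k x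
    using Bessel_term_le[OF sin_le[of "x / 2"], of 0 k] by (simp add: norm_mult)
  have sums: "(\<lambda>k. complex_of_real (Bessel_term 0 k (z * sin (x / 2))) * exp (- (\<i> * of_nat L * of_real x)))
      sums ?g x" for x
    by (intro sums_mult2 sums_of_real Bessel_J_sums)
  note * = has_integral_sums[OF int cont bound summable_Bessel_bound sums]
  show ?int by (rule *(1))
  \<comment> \<open>For k < L the power sin^(2k)(x/2) contains no mode \<open>L\<close>, so the
    series effectively starts at index \<open>L\<close>.\<close>
  have "(\<lambda>k. c (k + L) * I (k + L)) sums integral {0..2 * pi} ?g"
  proof (subst sums_mono_reindex)
    show "strict_mono (\<lambda>k. k + L)"
      by (simp add: strict_mono_def)
    show "c k * I k = 0" if "k \<notin> range (\<lambda>k. k + L)" for k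
    proof -
      have "\<not> L \<le> k"
        using that le_add_diff_inverse2[of L k] by (metis rangeI)
      then show ?thesis by (simp add: I_def)
    qed
  qed (rule *(2))
  moreover
  define d where "d k = Bessel_term (2 * L) k z * (2 * pi * ((2 * (k + L)) choose (k + L)) / 4 ^ (k + L))" for k
  have "d sums integral {0..2 * pi} (\<lambda>t. Bessel_J (2 * L) (z * sin t))"
  proof (rule has_integral_sums)
    fix k
    have "2 ^ (2 * (k + L)) = (4 ^ (k + L) :: complex)"
      by (simp only: power_mult) simp
    then have "((\<lambda>x. complex_of_real (sin x ^ (2 * (k + L)))) has_integral
        of_real (2 * pi * ((2 * (k + L)) choose (k + L)) / 4 ^ (k + L))) {0..2 * pi}"
      using has_integral_sin_power[of "2 * pi" 1 0 "2 * (k + L)"] by (simp del: distrib_left_numeral)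
    \<comment> \<open>The sine powers were integrated as complex functions; taking real parts gives
      the real integral.\<close>
    from has_integral_linear[OF this bounded_linear_Re]
    have "((\<lambda>x. sin x ^ (2 * (k + L))) has_integral
        (2 * pi * ((2 * (k + L)) choose (k + L)) / 4 ^ (k + L))) {0..2 * pi}"
      by (simp only: o_def Re_complex_of_real)
    then have "((\<lambda>x. Bessel_term (2 * L) k z * sin x ^ (2 * (k + L))) has_integral d k) {0..2 * pi}"
      unfolding d_def by (rule has_integral_mult_right)
    moreover have "Bessel_term (2 * L) k z * sin x ^ (2 * (k + L)) = Bessel_term (2 * L) k (z * sin x)" for x
      by (simp add: Bessel_term_def power_mult_distrib power_divide)
    ultimately show "((\<lambda>x. Bessel_term (2 * L) k (z * sin x)) has_integral d k) {0..2 * pi}"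
      by simp
    show "continuous_on {0..2 * pi} (\<lambda>x. Bessel_term (2 * L) k (z * sin x))"
      by (intro continuous_intros)
    show "norm (Bessel_term (2 * L) k (z * sin x)) \<le> Bessel_bound (2 * L) \<bar>z\<bar> k" for x
      using Bessel_term_le[OF sin_le[of x], of "2 * L" k] by simp
  qed (rule summable_Bessel_bound Bessel_J_sums)+
  then have "(\<lambda>k. complex_of_real (d k)) sums
      of_real (integral {0..2 * pi} (\<lambda>t. Bessel_J (2 * L) (z * sin t)))"
    by (rule sums_of_real)
  moreover have "c (k + L) * I (k + L) = complex_of_real (d k)" for k
  proof -
    have "c (k + L) * I (k + L) = complex_of_real
        (Bessel_term 0 (k + L) z * ((- 1) ^ L * of_nat (2 * (k + L) choose k)) * (2 * pi / 4 ^ (k + L)))"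
      by (simp add: c_def I_def)
    then show ?thesis
      unfolding Bessel_term_shift by (simp add: d_def)
  qed
  ultimately show ?eq
    by (auto intro: sums_unique2)
qed

section \<open>Spectrum of the mass matrix\<close>

text \<open>A geometric sum whose ratio \<open>z\<close> is a p-th root of unity; \<open>z\<close>
  is 1 exactly when \<open>p\<close> divides \<open>d\<close>.\<close>

lemma sum_cis_multiples:
  assumes p: "p \<ge> 1"
  shows "(\<Sum>j<p. cis (2 * pi * of_int d * real j / real p)) = (if int p dvd d then of_nat p else 0)"
proof -
  define z where "z = cis (2 * pi * of_int d / real p)"
  have pow: "cis (2 * pi * of_int d * real j / real p) = z ^ j" for j
    by (simp add: z_def Complex.DeMoivre mult.commute mult.left_commute)
  show ?thesis
  proof (cases "int p dvd d")
    case True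
    then obtain q where "d = int p * q" by blast
    then have "2 * pi * of_int d / real p = 2 * pi * of_int q"
      using p by simp
    then have "z = 1" by (simp only: z_def cis_multiple_2pi Ints_of_int)
    with True show ?thesis by (simp add: pow)
  next
    case False
    have "z \<noteq> 1"
    proof
      assume "z = 1"
      then have "cos (2 * pi * of_int d / real p) = 1"
        by (simp add: z_def complex_eq_iff)
      then obtain q :: int where "2 * pi * of_int d / real p = of_int q * 2 * pi"
        using cos_one_2pi_int by blast
      then have "real_of_int d = of_int (q * int p)"
        using p by (simp add: field_simps)
      then have "d = q * int p" by linarith
      with False show False by simp
    qed
    moreover have "z ^ p = 1"
      using p by (simp add: pow[symmetric])
    ultimately show ?thesis
      using False by (simp add: pow geometric_sum)
  qed
qed

lemma cis_mod:
  assumes p: "p \<ge> 1"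
  shows "cis (2 * pi * of_int d * real (n mod p) / real p) = cis (2 * pi * of_int d * real n / real p)"
proof -
  have "real n = real p * real (n div p) + real (n mod p)"
    by (metis mult_div_mod_eq of_nat_add of_nat_mult)
  then have "2 * pi * of_int d * real n / real p
      = 2 * pi * of_int (d * int (n div p)) + 2 * pi * of_int d * real (n mod p) / real p"
    using p by (simp add: field_simps)
  then have "cis (2 * pi * of_int d * real n / real p)
      = cis (2 * pi * of_int (d * int (n div p))) * cis (2 * pi * of_int d * real (n mod p) / real p)"
    by (simp only: cis_mult)
  also have "cis (2 * pi * of_int (d * int (n div p))) = 1"
    by (rule cis_multiple_2pi) (rule Ints_of_int)
  finally show ?thesis by simp
qed

lemma circ_eigenvalue_cis:
  "circ_eigenvalue C L =
     (\<Sum>j<dim_row C. C $$ (0, j) * cis (2 * pi * of_int (- int L) * real j / real (dim_row C)))"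
  unfolding circ_eigenvalue_def cis_conv_exp by (simp add: field_simps)

lemma circ_eigenvalue_circ:
  assumes "p \<ge> 1"
  shows "circ_eigenvalue (circ p c) L = (\<Sum>j<p. c j * cis (2 * pi * of_int (- int L) * real j / real p))"
  using assms by (simp add: circ_eigenvalue_cis circ_def)

text \<open>Substitution k = (j + p - i) mod p, a permutation of the indices. The second argument of
  \<open>f\<close> on the left is \<open>j\<close> itself, written through the new index.\<close>

lemma sum_cyclic_shift:
  fixes f :: "nat \<Rightarrow> nat \<Rightarrow> 'a :: comm_monoid_add"
  assumes "i < p"
  shows "(\<Sum>j<p. f ((j + p - i) mod p) ((i + (j + p - i) mod p) mod p)) = (\<Sum>k<p. f k ((i + k) mod p))"
proof (rule sum.reindex_bij_witness[where i = "\<lambda>k. (i + k) mod p" and j = "\<lambda>j. (j + p - i) mod p"])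
  fix j assume "j \<in> {..<p}"
  then show "(i + (j + p - i) mod p) mod p = j" "(j + p - i) mod p \<in> {..<p}"
    using assms by (auto simp: mod_simps)
next
  fix k assume k: "k \<in> {..<p}"
  show "(i + k) mod p \<in> {..<p}" using assms by auto
  show "((i + k) mod p + p - i) mod p = k"
  proof (cases "i + k < p")
    case False
    then have "(i + k) mod p = i + k - p"
      using k assms by (simp add: le_mod_geq)
    with False k show ?thesis by simp
  qed (use k in simp)
qed simp

text \<open>The columns of the Fourier matrix \<open>U\<close> are eigenvectors and \<open>V\<close>
  is its inverse, so the circulant is similar to the diagonal matrix \<open>D\<close> of its
  eigenvalues.\<close>

lemma char_poly_circ:
  assumes p: "p \<ge> 1"
  shows "char_poly (circ p c) = (\<Prod>L<p. [:- circ_eigenvalue (circ p c) L, 1:])"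
proof -
  define ev where "ev = circ_eigenvalue (circ p c)"
  define U where "U = mat p p (\<lambda>(j, L). cis (2 * pi * of_int (- int L) * real j / real p))"
  define V where "V = mat p p (\<lambda>(L, j). cis (2 * pi * of_int (int j) * real L / real p) / of_nat p)"
  define D where "D = mat p p (\<lambda>(i, j). if i = j then ev i else 0)"
  have carr: "U \<in> carrier_mat p p" "V \<in> carrier_mat p p" "D \<in> carrier_mat p p" "circ p c \<in> carrier_mat p p"
    by (simp_all add: U_def V_def D_def circ_def)
  have UV: "U * V = 1\<^sub>m p"
  proof (rule eq_matI)
    fix i j assume "i < dim_row (1\<^sub>m p)" "j < dim_col (1\<^sub>m p)"
    then have ij: "i < p" "j < p" by auto
    have "(U * V) $$ (i, j) = (\<Sum>L<p. cis (2 * pi * of_int (int j - int i) * real L / real p)) / of_nat p"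
      using ij by (simp add: U_def V_def scalar_prod_def cis_mult sum_divide_distrib
          lessThan_atLeast0 algebra_simps add_divide_distrib diff_divide_distrib)
    also have "\<dots> = (if i = j then 1 else 0)"
      \<comment> \<open>Since |j - i| < p, divisibility of j - i by \<open>p\<close> forces i =
        j.\<close>
      using ij p zdvd_imp_le[of "int p" "\<bar>int j - int i\<bar>"] sum_cis_multiples[OF p, of "int j - int i"]
      by (cases "i = j") auto
    finally show "(U * V) $$ (i, j) = 1\<^sub>m p $$ (i, j)" using ij by simp
  qed (use carr in auto)
  then have VU: "V * U = 1\<^sub>m p"
    using mat_mult_left_right_inverse carr by blast
  have "circ p c * U = U * D"
  proof (rule eq_matI)
    fix i L assume "i < dim_row (U * D)" "L < dim_col (U * D)"
    then have iL: "i < p" "L < p" using carr by auto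
    let ?e = "\<lambda>j. cis (2 * pi * of_int (- int L) * real j / real p)"
    have "(circ p c * U) $$ (i, L) = (\<Sum>j<p. c ((j + p - i) mod p) * ?e j)"
      using iL by (simp add: circ_def U_def scalar_prod_def lessThan_atLeast0)
    also have "\<dots> = (\<Sum>j<p. c ((j + p - i) mod p) * ?e ((i + (j + p - i) mod p) mod p))"
      using iL by (intro sum.cong) (auto simp: mod_simps)
    also have "\<dots> = (\<Sum>k<p. c k * ?e ((i + k) mod p))"
      by (rule sum_cyclic_shift[OF iL(1), of "\<lambda>k j. c k * ?e j"])
    also have "\<dots> = ?e i * (\<Sum>k<p. c k * ?e k)"
      unfolding cis_mod[OF p] sum_distrib_left
      by (intro sum.cong refl) (simp add: cis_mult ring_distribs add_divide_distrib diff_divide_distrib)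
    also have "\<dots> = ?e i * ev L"
      by (simp add: ev_def circ_eigenvalue_circ[OF p])
    also have "\<dots> = (U * D) $$ (i, L)"
      using iL by (simp add: U_def D_def scalar_prod_def if_distrib[of "\<lambda>x. _ * x"] sum.delta cong: if_cong)
    finally show "(circ p c * U) $$ (i, L) = (U * D) $$ (i, L)" .
  qed (use carr in auto)
  then have "U * D * V = circ p c * U * V" by simp
  also have "\<dots> = circ p c * (U * V)"
    using carr by (intro assoc_mult_mat)
  also have "\<dots> = circ p c"
    using carr UV by simp
  finally have "circ p c = U * D * V" ..
  then have "similar_mat (circ p c) D"
    unfolding similar_mat_def using similar_mat_witI[OF UV VU] carr by blast
  then have "char_poly (circ p c) = char_poly D"
    by (rule char_poly_similar)
  also have "\<dots> = (\<Prod>a\<leftarrow>diag_mat D. [:- a, 1:])"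
    by (rule char_poly_upper_triangular[OF carr(3)]) (auto simp: upper_triangular_def D_def)
  also have "diag_mat D = map ev [0..<p]"
    by (auto simp: diag_mat_def D_def)
  also have "(\<Prod>a\<leftarrow>map ev [0..<p]. [:- a, 1:]) = (\<Prod>L<p. [:- ev L, 1:])"
    using prod.distinct_set_conv_list[of "[0..<p]" "\<lambda>L. [:- ev L, 1:]"]
    by (simp add: o_def lessThan_atLeast0)
  finally show ?thesis by (simp add: ev_def)
qed

section \<open>Pairing of indices and multiplicities\<close>

text \<open>The reflection L -> p - L of the indices mod \<open>p\<close> fixes 0 and, for even
  \<open>p\<close>, p/2. Every other orbit has two elements, with one representative in
  \<open>{1..(p - 1) div 2}\<close>.\<close>

lemma prod_reflection:
  fixes f :: "nat \<Rightarrow> 'a :: comm_monoid_mult"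
  assumes p: "p \<ge> 1" and sym: "\<And>L. 1 \<le> L \<Longrightarrow> L < p \<Longrightarrow> f (p - L) = f L"
  shows "(\<Prod>L<p. f L) =
     f 0 * (\<Prod>L = 1..(p - 1) div 2. f L ^ 2) * (if even p then f (p div 2) else 1)"
proof -
  \<comment> \<open>\<open>?B\<close> is the mirror image of \<open>?A\<close>. For odd
    \<open>p\<close> it starts right after \<open>?A\<close>, since then p div 2 = (p - 1) div 2;
    for even \<open>p\<close> the midpoint in \<open>?C\<close> separates them.\<close>
  let ?A = "{1..(p - 1) div 2}" and ?B = "{p div 2 + 1..<p}" and ?C = "if even p then {p div 2} else {}"
  have "{..<p} = {0} \<union> ?A \<union> ?B \<union> ?C"
    using p by (auto elim!: evenE oddE)
  moreover have "prod f ({0} \<union> ?A \<union> ?B \<union> ?C) = prod f ({0} \<union> ?A \<union> ?B) * prod f ?C"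
    using p by (intro prod.union_disjoint) (auto elim!: evenE)
  moreover have "prod f ({0} \<union> ?A \<union> ?B) = prod f ({0} \<union> ?A) * prod f ?B"
    using p by (intro prod.union_disjoint) auto
  moreover have "prod f ({0} \<union> ?A) = f 0 * prod f ?A"
    by (subst prod.union_disjoint) auto
  moreover have "prod f ?B = prod f ?A"
    by (rule prod.reindex_bij_witness[where i = "\<lambda>L. p - L" and j = "\<lambda>L. p - L"])
      (use p in \<open>auto simp: sym\<close>)
  ultimately have "prod f {..<p} = f 0 * prod f ?A * prod f ?A * prod f ?C"
    by (simp only:)
  then show ?thesis
    by (simp add: power2_eq_square prod.distrib mult.assoc)
qed

lemma order_linear_factor: "Polynomial.order z [:- a, 1:] = (if a = z then 1 else 0)"
  for a z :: "'a :: idom"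
  using order_power_n_n[of a 1] by (auto intro: order_0I)

text \<open>The order is additive over products, which reduces an algebraic multiplicity to counting
  the indices that share an eigenvalue.\<close>

lemma order_prod_linear_factors:
  fixes a :: "'b \<Rightarrow> 'a :: idom"
  assumes "finite S"
  shows "Polynomial.order z (\<Prod>s\<in>S. [:- a s, 1:]) = card {s \<in> S. a s = z}"
  using assms
proof (induction S rule: finite_induct)
  case (insert s S)
  have "[:- a s, 1:] * (\<Prod>s\<in>S. [:- a s, 1:]) \<noteq> 0"
    using insert.hyps by (simp del: mult_pCons_left)
  then have "Polynomial.order z ([:- a s, 1:] * (\<Prod>s\<in>S. [:- a s, 1:])) =
      (if a s = z then 1 else 0) + card {s \<in> S. a s = z}"
    by (subst order_mult) (simp_all add: order_linear_factor insert.IH)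
  moreover have "{r \<in> insert s S. a r = z} =
      (if a s = z then insert s {r \<in> S. a r = z} else {r \<in> S. a r = z})"
    by auto
  ultimately show ?case
    using insert.hyps by (simp del: mult_pCons_left)
qed simp

section \<open>Entries and circulant structure of the mass matrix\<close>

lemma norm_vector_derivative_circle_curve:
  assumes "h > 0" "t \<in> {0..1}"
  shows "norm (vector_derivative (circle_curve h) (at t within {0..1})) = 2 * pi * h"
proof -
  have "((\<lambda>t. (h * cos (2 * pi * t), h * sin (2 * pi * t))) has_vector_derivative
      (- (2 * pi * h * sin (2 * pi * t)), 2 * pi * h * cos (2 * pi * t))) (at t within {0..1})"
    by (intro has_vector_derivative_Pair)
      (auto intro!: derivative_eq_intros simp flip: has_real_derivative_iff_has_vector_derivative)
  then have "vector_derivative (circle_curve h) (at t within {0..1}) =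
      (- (2 * pi * h * sin (2 * pi * t)), 2 * pi * h * cos (2 * pi * t))"
    unfolding circle_curve_def using assms(2)
    by (intro vector_derivative_within_closed_interval) auto
  then show ?thesis
    using assms(1) by (simp add: norm_prod_def power_mult_distrib real_sqrt_mult flip: distrib_left)
qed

lemma mass_matrix_entry:
  assumes h: "h > 0" and "m < p" "l < p"
  shows "mass_matrix \<kappa> h p $$ (m, l) = of_real (F_M \<kappa> h (theta p m - theta p l))"
proof -
  \<comment> \<open>Half-sum and half-difference of the two directions: they turn the difference of
    cosines in the phase into a product, leaving one sine in \<open>t\<close> of amplitude
    \<open>z\<close>, shifted by \<open>s\<close>.\<close>
  define s e z where "s = (theta p m + theta p l) / 2"
    and "e = (theta p m - theta p l) / 2" and "z = 2 * \<kappa> * h * sin e"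
  have th: "theta p m = s + e" "theta p l = s - e"
    by (simp_all add: s_def e_def field_simps)
  have phase: "\<kappa> * inner (wave_dir p m) (circle_curve h t) - \<kappa> * inner (wave_dir p l) (circle_curve h t)
      = z * sin (2 * pi * t - s)" for t
    by (simp add: wave_dir_def circle_curve_def th z_def cos_add sin_add cos_diff sin_diff algebra_simps)
  have "norm (vector_derivative (circle_curve h) (at t within {0..1})) *\<^sub>R
        (plane_wave \<kappa> p m (circle_curve h t) * cnj (plane_wave \<kappa> p l (circle_curve h t)))
      = of_real (2 * pi * h) * exp (\<i> * of_real (z * sin (2 * pi * t - s)))"
    if t: "t \<in> {0..1}" for t
    unfolding norm_vector_derivative_circle_curve[OF h t] phase[symmetric]
    by (simp add: plane_wave_def exp_cnj scaleR_conv_of_real exp_diff exp_minus field_simps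
        flip: exp_add)
  then have "mass_matrix \<kappa> h p $$ (m, l) =
      integral {0..1} (\<lambda>t. of_real (2 * pi * h) * exp (\<i> * of_real (z * sin (2 * pi * t - s))))"
    using assms(2,3) by (simp only: mass_matrix_def arclength_integral_def index_mat split_conv)
      (rule integral_cong)
  also have "\<dots> = of_real (2 * pi * h) * of_real (Bessel_J 0 z)"
    using Bessel_J_0_integral[of 1 "2 * pi" z s] by simp
  finally show ?thesis
    by (simp add: F_M_def z_def e_def)
qed

lemma F_M_minus: "F_M \<kappa> h (- x) = F_M \<kappa> h x"
  by (simp add: F_M_def Bessel_J_0_minus)

text \<open>The half-angle sine only changes sign under this shift; evenness of J_0 restores the
  period.\<close>

lemma F_M_plus_2pi: "F_M \<kappa> h (x + 2 * pi) = F_M \<kappa> h x"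
proof -
  have "sin ((x + 2 * pi) / 2) = - sin (x / 2)"
    by (simp add: add_divide_distrib)
  then show ?thesis by (simp add: F_M_def Bessel_J_0_minus)
qed

lemma mass_matrix_circ:
  assumes "h > 0"
  shows "mass_matrix \<kappa> h p = circ p (\<lambda>j. of_real (F_M \<kappa> h (2 * pi * real j / real p)))"
proof (rule eq_matI)
  fix i j assume "i < dim_row (circ p (\<lambda>j. of_real (F_M \<kappa> h (2 * pi * real j / real p))))"
    "j < dim_col (circ p (\<lambda>j. complex_of_real (F_M \<kappa> h (2 * pi * real j / real p))))"
  then have ij: "i < p" "j < p" by (auto simp: circ_def)
  \<comment> \<open>The cyclic index wraps around when j < i, which adds 2 pi to the angle;
    periodicity absorbs it.\<close>
  have "F_M \<kappa> h (2 * pi * real ((j + p - i) mod p) / real p) = F_M \<kappa> h (theta p j - theta p i)"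
  proof (cases "i \<le> j")
    case True
    then have "(j + p - i) mod p = j - i" using ij by (simp add: le_mod_geq)
    then show ?thesis using True by (simp add: theta_def of_nat_diff algebra_simps diff_divide_distrib)
  next
    case False
    then have "(j + p - i) mod p = j + p - i" using ij by simp
    moreover have "2 * pi * real (j + p - i) / real p = (theta p j - theta p i) + 2 * pi"
      using ij by (simp add: theta_def of_nat_diff field_simps)
    ultimately show ?thesis by (simp only: F_M_plus_2pi)
  qed
  \<comment> \<open>The circulant index is column minus row and the entry has row minus column;
    evenness reconciles the two.\<close>
  also have "\<dots> = F_M \<kappa> h (theta p i - theta p j)"
    using F_M_minus[of \<kappa> h "theta p i - theta p j"] by simp
  finally show "mass_matrix \<kappa> h p $$ (i, j)
      = circ p (\<lambda>j. of_real (F_M \<kappa> h (2 * pi * real j / real p))) $$ (i, j)"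
    using assms ij by (simp add: mass_matrix_entry circ_def)
qed (auto simp: mass_matrix_def circ_def)

lemma circ_eigenvalue_mass_matrix:
  assumes "h > 0" "p \<ge> 1"
  shows "circ_eigenvalue (mass_matrix \<kappa> h p) L =
    (\<Sum>j<p. of_real (F_M \<kappa> h (2 * pi * real j / real p)) * cis (2 * pi * of_int (- int L) * real j / real p))"
  unfolding mass_matrix_circ[OF assms(1)] by (rule circ_eigenvalue_circ[OF assms(2)])

text \<open>Reindex the sum by j -> -j mod \<open>p\<close>. The samples of the even periodic
  \<open>F_M\<close> are unchanged, while the character of index \<open>L\<close> becomes that of
  index p - L.\<close>

lemma circ_eigenvalue_reflection:
  assumes h: "h > 0" and p: "p \<ge> 1" and L: "L \<le> p"
  shows "circ_eigenvalue (mass_matrix \<kappa> h p) (p - L) = circ_eigenvalue (mass_matrix \<kappa> h p) L"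
proof -
  let ?F = "\<lambda>j. complex_of_real (F_M \<kappa> h (2 * pi * real j / real p))"
  let ?e = "\<lambda>d j. cis (2 * pi * of_int d * real j / real p)"
  \<comment> \<open>The reduction mod \<open>p\<close> matters at j = 0, which it sends to 0 instead
    of \<open>p\<close>.\<close>
  have invol: "(p - (p - j) mod p) mod p = j" if "j < p" for j
    using that by (cases "j = 0") auto
  have refl_F: "?F ((p - j) mod p) = ?F j" if "j < p" for j
  proof (cases "j = 0")
    case False
    then have "2 * pi * real ((p - j) mod p) / real p = - (2 * pi * real j / real p) + 2 * pi"
      using that by (simp add: of_nat_diff field_simps)
    then show ?thesis by (simp only: F_M_plus_2pi F_M_minus)
  qed simp
  have "circ_eigenvalue (mass_matrix \<kappa> h p) (p - L) = (\<Sum>j<p. ?F j * ?e (- int (p - L)) j)"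
    by (rule circ_eigenvalue_mass_matrix[OF h p])
  also have "\<dots> = (\<Sum>j<p. ?F j * ?e (- int L) j)"
  proof (rule sum.reindex_bij_witness[where i = "\<lambda>j. (p - j) mod p" and j = "\<lambda>j. (p - j) mod p"])
    fix j assume "j \<in> {..<p}"
    then have j: "j < p" by simp
    have "?e (- int L) ((p - j) mod p) = ?e (- int L) (p - j)"
      by (rule cis_mod[OF p])
    also have "2 * pi * of_int (- int L) * real (p - j) / real p
        = 2 * pi * of_int (- int (p - L)) * real j / real p + 2 * pi * of_int (int j - int L)"
      using j L by (simp add: of_nat_diff field_simps)
    also have "cis \<dots> = ?e (- int (p - L)) j"
      by (simp only: cis_mult[symmetric] cis_multiple_2pi[OF Ints_of_int] mult_1_right)
    finally show "?F ((p - j) mod p) * ?e (- int L) ((p - j) mod p) = ?F j * ?e (- int (p - L)) j"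
      using refl_F[OF j] by simp
  qed (use invol p in auto)
  also have "\<dots> = circ_eigenvalue (mass_matrix \<kappa> h p) L"
    by (rule circ_eigenvalue_mass_matrix[OF h p, symmetric])
  finally show ?thesis .
qed

lemma char_poly_mass_matrix:
  assumes "h > 0" "p \<ge> 1"
  shows "char_poly (mass_matrix \<kappa> h p) = (\<Prod>L<p. [:- circ_eigenvalue (mass_matrix \<kappa> h p) L, 1:])"
  unfolding mass_matrix_circ[OF assms(1)] by (rule char_poly_circ[OF assms(2)])

lemma eigenvalue_mass_matrix:
  assumes "h > 0" "p \<ge> 1" "L < p"
  shows "eigenvalue (mass_matrix \<kappa> h p) (circ_eigenvalue (mass_matrix \<kappa> h p) L)"
proof -
  have "mass_matrix \<kappa> h p \<in> carrier_mat p p" by (simp add: mass_matrix_def)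
  then show ?thesis
    using assms(3) by (auto simp: eigenvalue_root_char_poly char_poly_mass_matrix[OF assms(1,2)] poly_prod)
qed

text \<open>The multiplicity counts the indices with the same eigenvalue. Folding \<open>L\<close>
  to \<open>min L (p - L)\<close> brings each index into \<open>{0..p div 2}\<close>, where
  \<open>no_coincidence\<close> gives injectivity.\<close>

lemma alg_multiplicity_mass_matrix:
  assumes h: "h > 0" and p: "p \<ge> 1" and nc: "no_coincidence \<kappa> h p" and K: "K \<le> p div 2"
  shows "alg_multiplicity (mass_matrix \<kappa> h p) (circ_eigenvalue (mass_matrix \<kappa> h p) K)
    = card {L. L < p \<and> (L = K \<or> L = p - K)}"
proof -
  let ?ev = "circ_eigenvalue (mass_matrix \<kappa> h p)"
  have "?ev L = ?ev K \<longleftrightarrow> L = K \<or> L = p - K" if L: "L < p" for L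
  proof -
    have min: "?ev L = ?ev (min L (p - L))"
      using circ_eigenvalue_reflection[OF h p, of L] L by (simp add: min_def)
    have "min L (p - L) \<in> {0..p div 2}" "K \<in> {0..p div 2}"
      using L K by auto
    then have "?ev L = ?ev K \<longleftrightarrow> min L (p - L) = K"
      using nc unfolding no_coincidence_def min by (rule inj_on_eq_iff[rotated])
    also have "\<dots> \<longleftrightarrow> L = K \<or> L = p - K"
      using L K by (auto simp: min_def)
    finally show ?thesis .
  qed
  then have "{L \<in> {..<p}. ?ev L = ?ev K} = {L. L < p \<and> (L = K \<or> L = p - K)}"
    by auto
  then show ?thesis
    by (simp add: alg_multiplicity_def char_poly_mass_matrix[OF h p] order_prod_linear_factors)
qed

text \<open>The factor 2 pi h in \<open>F_M\<close> meets the p / (2 pi) of the trapezoidal rule,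
  which leaves the prefactor h p.\<close>

lemma trapezoidal_approx_mass_matrix:
  assumes h: "h > 0" and p: "p \<ge> 1"
  shows "trapezoidal_approx p (\<lambda>x. of_real (F_M \<kappa> h x)) L (circ_eigenvalue (mass_matrix \<kappa> h p) L)
     (of_real (h * real p * integral {0..2 * pi} (\<lambda>t. Bessel_J (2 * L) (2 * \<kappa> * h * sin t))))"
proof -
  let ?f = "\<lambda>x. of_real (Bessel_J 0 (2 * \<kappa> * h * sin (x / 2))) * exp (- (\<i> * of_nat L * of_real x))"
  have F: "of_real (F_M \<kappa> h x) * exp (- (\<i> * of_nat L * of_real x)) = of_real (2 * pi * h) * ?f x" for x
    by (simp add: F_M_def)
  have "(\<lambda>x. of_real (2 * pi * h) * ?f x) integrable_on {0..2 * pi}"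
    by (intro integrable_on_mult_right integral_Bessel_J_fourier)
  then show ?thesis
    unfolding trapezoidal_approx_def F integral_mult_right integral_Bessel_J_fourier
    by (auto simp: circ_eigenvalue_mass_matrix[OF h p] cis_conv_exp field_simps)
qed

section \<open>Coincidences of eigenvalues\<close>

lemma powser_zero_coeff:
  fixes a :: "nat \<Rightarrow> 'a :: {real_normed_field, banach}"
  assumes "\<And>x. (\<lambda>n. a n * x ^ n) sums 0"
  shows "a m = 0"
proof (rule ccontr)
  assume "a m \<noteq> 0"
  moreover have "a 0 = 0"
    using sums_unique2[OF assms[of 0] powser_sums_zero] by simp
  ultimately have "m > 0" by (cases m) auto
  show False
  proof (rule powser_0_nonzero[of 1 0 a "\<lambda>_. 0" m])
    fix s :: real
    assume s: "0 < s" and ne: "\<And>z :: 'a. z \<in> cball 0 s - {0} \<Longrightarrow> (0 :: 'a) \<noteq> 0"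
    from s have "of_real s \<in> cball 0 s - {0 :: 'a}" by simp
    from ne[OF this] show False by simp
  qed (use assms \<open>a m \<noteq> 0\<close> \<open>m > 0\<close> in auto)
qed

text \<open>If \<open>f\<close> is constant, the constant is not 0 because the coefficient
  \<open>a m\<close> is not. Otherwise \<open>f\<close> is entire and nonconstant, and its zeros
  cannot accumulate in a compact set.\<close>

lemma entire_powser_finite_zeros:
  fixes a :: "nat \<Rightarrow> complex"
  assumes f: "\<And>u. (\<lambda>n. a n * u ^ n) sums f u" and m: "a m \<noteq> 0" and K: "compact K"
  shows "finite {u \<in> K. f u = 0}"
proof (cases "f constant_on UNIV")
  case True
  then obtain c where c: "\<And>u. f u = c" unfolding constant_on_def by blast
  have "c \<noteq> 0"
  proof
    assume "c = 0"
    then have "a m = 0" using f c by (intro powser_zero_coeff) simp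
    with m show False by blast
  qed
  then show ?thesis by (simp add: c)
next
  case False
  have "f holomorphic_on ball 0 r" for r
    using power_series_holomorphic[of 0 r a f] f by simp
  then have "f holomorphic_on UNIV"
    unfolding holomorphic_on_def
    by (metis UNIV_I at_within_open centre_in_ball dist_norm field_differentiable_at_within
        holomorphic_on_imp_differentiable_at mem_ball open_ball zero_less_dist_iff gt_ex dist_0_norm)
  then show ?thesis
    using False K by (intro holomorphic_compact_finite_zeros[where S = UNIV]) auto
qed

section \<open>Discrete Fourier coefficients of sine powers\<close>

text \<open>Discrete counterpart of \<open>has_integral_sin_half_even_power\<close>, with aliasing:
  a mode survives when \<open>p\<close> divides its frequency, not only at frequency 0.\<close>

lemma sum_sin_power_cis:
  assumes p: "p \<ge> 1"
  shows "(\<Sum>j<p. of_real (sin (pi * real j / real p)) ^ (2 * k) * cis (2 * pi * of_int (- int L) * real j / real p)) =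
    (\<Sum>m\<le>2 * k. of_nat (2 * k choose m) * (- 1) ^ (m + k) / 4 ^ k *
       (if int p dvd int k - int m - int L then of_nat p else 0))"
proof -
  have "of_real (sin (pi * real j / real p)) ^ (2 * k) * cis (2 * pi * of_int (- int L) * real j / real p)
      = (\<Sum>m\<le>2 * k. of_nat (2 * k choose m) * (- 1) ^ (m + k) / 4 ^ k *
          cis (2 * pi * of_int (int k - int m - int L) * real j / real p))" for j
  proof -
    have "exp (\<i> * of_int (int k - int m) * of_real (2 * pi * real j / real p)) *
        cis (2 * pi * of_int (- int L) * real j / real p)
        = cis (2 * pi * of_int (int k - int m - int L) * real j / real p)" for m
      unfolding cis_conv_exp exp_add[symmetric] by (simp add: algebra_simps diff_divide_distrib add_divide_distrib)
    then show ?thesis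
      using sin_half_even_power_exp[of "2 * pi * real j / real p" k]
      by (simp add: sum_distrib_right mult.assoc)
  qed
  then have "(\<Sum>j<p. of_real (sin (pi * real j / real p)) ^ (2 * k) * cis (2 * pi * of_int (- int L) * real j / real p))
      = (\<Sum>m\<le>2 * k. \<Sum>j<p. of_nat (2 * k choose m) * (- 1) ^ (m + k) / 4 ^ k *
          cis (2 * pi * of_int (int k - int m - int L) * real j / real p))"
    by (simp add: sum.swap[of _ "{..<p}"])
  then show ?thesis
    by (simp only: sum_distrib_left[symmetric] sum_cis_multiples[OF p])
qed

text \<open>The frequencies are -m with 0 \<le> m \<le> 2L < p, so only m = 0 contributes and no
  aliasing occurs.\<close>

lemma sum_sin_power_cis_diag:
  assumes L: "2 * L < p"
  shows "(\<Sum>j<p. of_real (sin (pi * real j / real p)) ^ (2 * L) * cis (2 * pi * of_int (- int L) * real j / real p))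
    = (- 1) ^ L / 4 ^ L * of_nat p"
proof -
  have "int p dvd int L - int m - int L \<longleftrightarrow> m = 0" if "m \<le> 2 * L" for m
    using zdvd_imp_le[of "int p" "int m"] that L by auto
  then have "(\<Sum>m\<le>2 * L. of_nat (2 * L choose m) * (- 1) ^ (m + L) / 4 ^ L *
       (if int p dvd int L - int m - int L then of_nat p else 0)) =
     (\<Sum>m\<le>2 * L. if m = 0 then (- 1) ^ L / 4 ^ L * of_nat p else (0 :: complex))"
    by (intro sum.cong) auto
  also have "\<dots> = (- 1) ^ L / 4 ^ L * of_nat p" by simp
  finally show ?thesis
    using L by (subst sum_sin_power_cis) auto
qed

text \<open>The frequencies L - m - L' run from -(L + L') to L - L', strictly between -p and 0
  because L + L' < 2L' \<le> p.\<close>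

lemma sum_sin_power_cis_above:
  assumes "L < L'" "2 * L' \<le> p"
  shows "(\<Sum>j<p. of_real (sin (pi * real j / real p)) ^ (2 * L) * cis (2 * pi * of_int (- int L') * real j / real p)) = 0"
proof -
  have "\<not> int p dvd int L - int m - int L'" if "m \<le> 2 * L" for m
  proof
    assume "int p dvd int L - int m - int L'"
    then have "int p dvd int m + int L' - int L"
      by (metis dvd_minus_iff minus_diff_eq diff_diff_eq2 add_diff_eq diff_add_eq add.commute diff_diff_eq)
    then have "int p \<le> int m + int L' - int L"
      using assms by (intro zdvd_imp_le) auto
    then show False using that assms by linarith
  qed
  then show ?thesis
    using assms by (subst sum_sin_power_cis) (auto intro!: sum.neutral)
qed

section \<open>Finiteness of coincidences in bounded ranges of wave numbers\<close>

lemma finite_coincidences: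
  assumes h: "h > 0" and L: "L < L'" "2 * L' \<le> p"
  shows "finite {\<kappa>. \<bar>\<kappa>\<bar> \<le> R \<and>
    circ_eigenvalue (mass_matrix \<kappa> h p) L = circ_eigenvalue (mass_matrix \<kappa> h p) L'}"
proof -
  have p: "p \<ge> 1" using L by simp
  let ?e = "\<lambda>L j. cis (2 * pi * of_int (- int L) * real j / real p)"
  define s where "s j = sin (pi * real j / real p)" for j
  \<comment> \<open>\<open>b\<close> holds the coefficients of 2 pi h J_0(2 \<kappa> h s) in powers
    of (\<kappa> s)^2; \<open>d\<close> collects those of the eigenvalue difference in u =
    \<kappa>^2.\<close>
  define b where "b k = 2 * pi * h * ((- 1) ^ k / (fact k * fact k) * h ^ (2 * k))" for k
  define d where "d k = of_real (b k) * (\<Sum>j<p. of_real (s j) ^ (2 * k) * (?e L j - ?e L' j))" for k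
  define f where "f u = (\<Sum>k. d k * u ^ k)" for u
  have F_sums: "(\<lambda>k. b k * s j ^ (2 * k) * (\<kappa>\<^sup>2) ^ k) sums F_M \<kappa> h (2 * pi * real j / real p)" for \<kappa> j
  proof -
    have "(\<lambda>k. 2 * pi * h * Bessel_term 0 k (2 * \<kappa> * h * s j)) sums F_M \<kappa> h (2 * pi * real j / real p)"
      unfolding F_M_def s_def using sums_mult[OF Bessel_J_sums] by simp
    moreover have "2 * pi * h * Bessel_term 0 k (2 * \<kappa> * h * s j) = b k * s j ^ (2 * k) * (\<kappa>\<^sup>2) ^ k" for k
    proof -
      have "2 * \<kappa> * h * s j / 2 = h * s j * \<kappa>" by simp
      then have "(2 * \<kappa> * h * s j / 2) ^ (2 * k + 0) = h ^ (2 * k) * s j ^ (2 * k) * (\<kappa>\<^sup>2) ^ k"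
        by (simp only: power_mult_distrib power_mult add_0_right)
      then show ?thesis
        unfolding Bessel_term_def b_def by simp
    qed
    ultimately show ?thesis by simp
  qed
  have ev_sums: "(\<lambda>k. d k * of_real (\<kappa>\<^sup>2) ^ k) sums
      (circ_eigenvalue (mass_matrix \<kappa> h p) L - circ_eigenvalue (mass_matrix \<kappa> h p) L')" for \<kappa>
  proof -
    have "(\<lambda>k. \<Sum>j<p. of_real (b k * s j ^ (2 * k) * (\<kappa>\<^sup>2) ^ k) * (?e L j - ?e L' j)) sums
        (\<Sum>j<p. of_real (F_M \<kappa> h (2 * pi * real j / real p)) * (?e L j - ?e L' j))"
      by (intro sums_sum sums_mult2 sums_of_real F_sums)
    moreover have "(\<Sum>j<p. of_real (F_M \<kappa> h (2 * pi * real j / real p)) * (?e L j - ?e L' j)) =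
        circ_eigenvalue (mass_matrix \<kappa> h p) L - circ_eigenvalue (mass_matrix \<kappa> h p) L'"
      by (simp only: circ_eigenvalue_mass_matrix[OF h p] right_diff_distrib sum_subtractf)
    moreover have "(\<Sum>j<p. of_real (b k * s j ^ (2 * k) * (\<kappa>\<^sup>2) ^ k) * (?e L j - ?e L' j)) =
        d k * of_real (\<kappa>\<^sup>2) ^ k" for k
      unfolding d_def sum_distrib_left sum_distrib_right
      by (intro sum.cong refl) (simp add: mult_ac)
    ultimately show ?thesis by simp
  qed
  \<comment> \<open>So far convergence is known at the real points u = \<kappa>^2. Comparing with
    the larger point |u| + 1 of this form extends it to the whole complex plane.\<close>
  have "summable (\<lambda>k. d k * u ^ k)" for u
  proof (rule powser_inside)
    show "summable (\<lambda>k. d k * of_real ((sqrt (norm u + 1))\<^sup>2) ^ k)"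
      using ev_sums sums_summable by blast
    show "norm u < norm (complex_of_real ((sqrt (norm u + 1))\<^sup>2))"
      by simp
  qed
  then have f: "(\<lambda>k. d k * u ^ k) sums f u" for u
    unfolding f_def by (rule summable_sums)
  have f_ev: "f (of_real (\<kappa>\<^sup>2)) = circ_eigenvalue (mass_matrix \<kappa> h p) L - circ_eigenvalue (mass_matrix \<kappa> h p) L'" for \<kappa>
    using f ev_sums by (rule sums_unique2)
  \<comment> \<open>At order \<open>L\<close> the smaller index contributes a nonzero term and
    \<open>L'\<close> contributes nothing, so this coefficient of the difference survives.\<close>
  have "(\<Sum>j<p. of_real (s j) ^ (2 * L) * (?e L j - ?e L' j)) = (- 1) ^ L / 4 ^ L * of_nat p"
    using sum_sin_power_cis_diag[of L p] sum_sin_power_cis_above[OF L] L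
    by (simp only: s_def right_diff_distrib sum_subtractf) simp
  then have "d L \<noteq> 0"
    using h p by (simp add: d_def b_def)
  then have fin: "finite {u \<in> cball 0 (R\<^sup>2). f u = 0}"
    by (intro entire_powser_finite_zeros[OF f]) auto
  \<comment> \<open>Back from u to \<kappa>: every u has at most two real square roots.\<close>
  have "finite {\<kappa>. complex_of_real (\<kappa>\<^sup>2) = u}" for u
  proof (rule finite_subset)
    show "{\<kappa>. complex_of_real (\<kappa>\<^sup>2) = u} \<subseteq> {sqrt (Re u), - sqrt (Re u)}"
    proof
      fix \<kappa> assume "\<kappa> \<in> {\<kappa>. complex_of_real (\<kappa>\<^sup>2) = u}"
      then have "Re u = \<kappa>\<^sup>2" by (metis Re_complex_of_real mem_Collect_eq)
      then show "\<kappa> \<in> {sqrt (Re u), - sqrt (Re u)}" by auto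
    qed
  qed simp
  then have "finite (\<Union>u \<in> {u \<in> cball 0 (R\<^sup>2). f u = 0}. {\<kappa>. complex_of_real (\<kappa>\<^sup>2) = u})"
    using fin by blast
  moreover have "\<kappa> \<in> (\<Union>u \<in> {u \<in> cball 0 (R\<^sup>2). f u = 0}. {\<kappa>. complex_of_real (\<kappa>\<^sup>2) = u})"
    if "\<bar>\<kappa>\<bar> \<le> R" "circ_eigenvalue (mass_matrix \<kappa> h p) L = circ_eigenvalue (mass_matrix \<kappa> h p) L'" for \<kappa>
  proof -
    have "\<bar>\<kappa>\<^sup>2\<bar> \<le> R\<^sup>2"
      using that(1) power_mono[of "\<bar>\<kappa>\<bar>" R 2] by simp
    then have "norm (complex_of_real (\<kappa>\<^sup>2)) \<le> R\<^sup>2"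
      by (simp only: norm_of_real)
    then show ?thesis
      using that(2) f_ev[of \<kappa>] by (simp only: UN_iff mem_Collect_eq mem_cball_0) auto
  qed
  ultimately show ?thesis
    by - (erule rev_finite_subset, blast)
qed

text \<open>Failure of injectivity is a coincidence for one of finitely many pairs L < L' \<le> p/2,
  so the exceptional set lies in a finite union of finite sets.\<close>

lemma finite_not_no_coincidence:
  assumes h: "h > 0"
  shows "finite {\<kappa>. \<bar>\<kappa>\<bar> \<le> R \<and> \<not> no_coincidence \<kappa> h p}"
proof (rule finite_subset)
  let ?E = "\<lambda>(L, L'). {\<kappa>. \<bar>\<kappa>\<bar> \<le> R \<and>
    circ_eigenvalue (mass_matrix \<kappa> h p) L = circ_eigenvalue (mass_matrix \<kappa> h p) L'}"
  let ?P = "{(L, L'). L < L' \<and> 2 * L' \<le> p}"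
  show "{\<kappa>. \<bar>\<kappa>\<bar> \<le> R \<and> \<not> no_coincidence \<kappa> h p} \<subseteq> (\<Union>x \<in> ?P. ?E x)"
  proof
    fix \<kappa> assume "\<kappa> \<in> {\<kappa>. \<bar>\<kappa>\<bar> \<le> R \<and> \<not> no_coincidence \<kappa> h p}"
    then obtain L L' where "\<bar>\<kappa>\<bar> \<le> R" "L \<in> {0..p div 2}" "L' \<in> {0..p div 2}" "L \<noteq> L'"
      "circ_eigenvalue (mass_matrix \<kappa> h p) L = circ_eigenvalue (mass_matrix \<kappa> h p) L'"
      unfolding no_coincidence_def inj_on_def by blast
    then have "(min L L', max L L') \<in> ?P" "\<kappa> \<in> ?E (min L L', max L L')"
      by (auto simp: min_def max_def)
    then show "\<kappa> \<in> (\<Union>x \<in> ?P. ?E x)" by blast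
  qed
  have "finite ?P"
    by (rule finite_subset[of _ "{..p} \<times> {..p}"]) auto
  then show "finite (\<Union>x \<in> ?P. ?E x)"
    using finite_coincidences[OF h] by auto
qed

theorem theorem3p3:
  fixes \<kappa> h :: real and p :: nat
  assumes h: "h > 0" and p: "p \<ge> 1"
  shows
    "\<comment> \<open>(1)\<close>
     generating_function (\<lambda>x. of_real (F_M \<kappa> h x)) (mass_matrix \<kappa> h p) \<and>

     \<comment> \<open>the eigenvalues of \<open>M\<close> listed with multiplicity: \<open>\<lambda>\<^sub>0\<close> once, each of the
        \<open>\<lambda>\<^sub>L\<close> with \<open>1 \<le> L \<le> (p - 1) div 2\<close> twice, and \<open>\<lambda>\<^bsub>p/2\<^esub>\<close> once if \<open>p\<close> is even\<close>
     char_poly (mass_matrix \<kappa> h p) =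
       [:- circ_eigenvalue (mass_matrix \<kappa> h p) 0, 1:]
       * (\<Prod>L = 1..(p - 1) div 2. [:- circ_eigenvalue (mass_matrix \<kappa> h p) L, 1:] ^ 2)
       * (if even p then [:- circ_eigenvalue (mass_matrix \<kappa> h p) (p div 2), 1:] else 1) \<and>

     \<comment> \<open>for fixed \<open>h\<close> and \<open>p\<close>, coincidences between these occur only for isolated wave numbers\<close>
     (\<forall>R :: real. finite {\<kappa>'. \<bar>\<kappa>'\<bar> \<le> R \<and> \<not> no_coincidence \<kappa>' h p}) \<and>

     \<comment> \<open>(2)\<close>
     (eigenvalue (mass_matrix \<kappa> h p) (circ_eigenvalue (mass_matrix \<kappa> h p) 0) \<and>
      (no_coincidence \<kappa> h p \<longrightarrow>
         alg_multiplicity (mass_matrix \<kappa> h p) (circ_eigenvalue (mass_matrix \<kappa> h p) 0) = 1) \<and>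
      circ_eigenvalue (mass_matrix \<kappa> h p) 0 =
        (\<Sum>j<p. of_real (F_M \<kappa> h (2 * real j / real p * pi))) \<and>
      trapezoidal_approx p (\<lambda>x. of_real (F_M \<kappa> h x)) 0
        (circ_eigenvalue (mass_matrix \<kappa> h p) 0)
        (of_real (real p * h * integral {0..2 * pi} (\<lambda>x. Bessel_J 0 (2 * \<kappa> * h * sin x))))) \<and>

     \<comment> \<open>(3)\<close>
     (\<forall>L \<in> {1..(p - 1) div 2}.
        eigenvalue (mass_matrix \<kappa> h p) (circ_eigenvalue (mass_matrix \<kappa> h p) L) \<and>
        circ_eigenvalue (mass_matrix \<kappa> h p) (p - L) = circ_eigenvalue (mass_matrix \<kappa> h p) L \<and>
        (no_coincidence \<kappa> h p \<longrightarrow>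
           alg_multiplicity (mass_matrix \<kappa> h p) (circ_eigenvalue (mass_matrix \<kappa> h p) L) = 2) \<and>
        circ_eigenvalue (mass_matrix \<kappa> h p) L =
          (\<Sum>j<p. of_real (F_M \<kappa> h (2 * real j / real p * pi))
             * exp (- (\<i> * of_real (2 * real j / real p * real L * pi)))) \<and>
        trapezoidal_approx p (\<lambda>x. of_real (F_M \<kappa> h x)) L
          (circ_eigenvalue (mass_matrix \<kappa> h p) L)
          (of_real (h * real p *
             integral {0..2 * pi} (\<lambda>t. Bessel_J (2 * L) (2 * \<kappa> * h * sin t))))) \<and>

     \<comment> \<open>(4)\<close>
     (even p \<longrightarrow>
        eigenvalue (mass_matrix \<kappa> h p) (circ_eigenvalue (mass_matrix \<kappa> h p) (p div 2)) \<and>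
        (no_coincidence \<kappa> h p \<longrightarrow>
           alg_multiplicity (mass_matrix \<kappa> h p)
             (circ_eigenvalue (mass_matrix \<kappa> h p) (p div 2)) = 1) \<and>
        circ_eigenvalue (mass_matrix \<kappa> h p) (p div 2) =
          (\<Sum>j<p. (- 1) ^ j * of_real (F_M \<kappa> h (2 * real j / real p * pi))) \<and>
        trapezoidal_approx p (\<lambda>x. of_real (F_M \<kappa> h x)) (p div 2)
          (circ_eigenvalue (mass_matrix \<kappa> h p) (p div 2))
          (of_real (h * real p *
             integral {0..2 * pi} (\<lambda>t. Bessel_J p (2 * \<kappa> * h * sin t)))))"
proof -
  let ?M = "mass_matrix \<kappa> h p"
  let ?ev = "circ_eigenvalue ?M"
  note ev = circ_eigenvalue_mass_matrix[OF h p]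
  note mult = alg_multiplicity_mass_matrix[OF h p]
  note trapezoidal = trapezoidal_approx_mass_matrix[OF h p]
  have "dim_row ?M = p" by (simp add: mass_matrix_def)
  then have generating: "generating_function (\<lambda>x. of_real (F_M \<kappa> h x)) ?M"
    unfolding generating_function_def using mass_matrix_circ[OF h] by simp
  have char_poly: "char_poly ?M = [:- ?ev 0, 1:] * (\<Prod>L = 1..(p - 1) div 2. [:- ?ev L, 1:] ^ 2)
      * (if even p then [:- ?ev (p div 2), 1:] else 1)"
    unfolding char_poly_mass_matrix[OF h p]
    by (rule prod_reflection[OF p]) (simp add: circ_eigenvalue_reflection[OF h p])
  have zero: "eigenvalue ?M (?ev 0) \<and>
      (no_coincidence \<kappa> h p \<longrightarrow> alg_multiplicity ?M (?ev 0) = 1) \<and>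
      ?ev 0 = (\<Sum>j<p. of_real (F_M \<kappa> h (2 * real j / real p * pi))) \<and>
      trapezoidal_approx p (\<lambda>x. of_real (F_M \<kappa> h x)) 0 (?ev 0)
        (of_real (real p * h * integral {0..2 * pi} (\<lambda>x. Bessel_J 0 (2 * \<kappa> * h * sin x))))"
  proof (intro conjI impI)
    show "eigenvalue ?M (?ev 0)"
      using p by (intro eigenvalue_mass_matrix[OF h p]) simp
    \<comment> \<open>The mirror index p - 0 = p lies outside the range, so 0 has no
      partner.\<close>
    have "{L. L < p \<and> (L = 0 \<or> L = p - 0)} = {0}" using p by auto
    then show "alg_multiplicity ?M (?ev 0) = 1" if "no_coincidence \<kappa> h p"
      using mult[OF that, of 0] by simp
    show "?ev 0 = (\<Sum>j<p. of_real (F_M \<kappa> h (2 * real j / real p * pi)))"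
      unfolding ev by (simp add: mult_ac)
    show "trapezoidal_approx p (\<lambda>x. of_real (F_M \<kappa> h x)) 0 (?ev 0)
        (of_real (real p * h * integral {0..2 * pi} (\<lambda>x. Bessel_J 0 (2 * \<kappa> * h * sin x))))"
      using trapezoidal[of \<kappa> 0] by (simp add: mult.commute[of h])
  qed
  have double: "eigenvalue ?M (?ev L) \<and> ?ev (p - L) = ?ev L \<and>
      (no_coincidence \<kappa> h p \<longrightarrow> alg_multiplicity ?M (?ev L) = 2) \<and>
      ?ev L = (\<Sum>j<p. of_real (F_M \<kappa> h (2 * real j / real p * pi))
        * exp (- (\<i> * of_real (2 * real j / real p * real L * pi)))) \<and>
      trapezoidal_approx p (\<lambda>x. of_real (F_M \<kappa> h x)) L (?ev L)
        (of_real (h * real p * integral {0..2 * pi} (\<lambda>t. Bessel_J (2 * L) (2 * \<kappa> * h * sin t))))"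
    if "L \<in> {1..(p - 1) div 2}" for L
  proof (intro conjI impI)
    from that have L: "1 \<le> L" "2 * L < p" by auto
    show "eigenvalue ?M (?ev L)"
      using L by (intro eigenvalue_mass_matrix[OF h p]) simp
    show "?ev (p - L) = ?ev L"
      using L by (intro circ_eigenvalue_reflection[OF h p]) simp
    have "{K. K < p \<and> (K = L \<or> K = p - L)} = {L, p - L}" "L \<noteq> p - L" using L by auto
    then show "alg_multiplicity ?M (?ev L) = 2" if "no_coincidence \<kappa> h p"
      using mult[OF that, of L] L by simp
    show "?ev L = (\<Sum>j<p. of_real (F_M \<kappa> h (2 * real j / real p * pi))
        * exp (- (\<i> * of_real (2 * real j / real p * real L * pi))))"
      unfolding ev cis_conv_exp by (simp add: mult_ac)
  qed (rule trapezoidal)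
  have half: "eigenvalue ?M (?ev (p div 2)) \<and>
      (no_coincidence \<kappa> h p \<longrightarrow> alg_multiplicity ?M (?ev (p div 2)) = 1) \<and>
      ?ev (p div 2) = (\<Sum>j<p. (- 1) ^ j * of_real (F_M \<kappa> h (2 * real j / real p * pi))) \<and>
      trapezoidal_approx p (\<lambda>x. of_real (F_M \<kappa> h x)) (p div 2) (?ev (p div 2))
        (of_real (h * real p * integral {0..2 * pi} (\<lambda>t. Bessel_J p (2 * \<kappa> * h * sin t))))"
    if "even p"
  proof (intro conjI impI)
    from that obtain q where q: "p = 2 * q" by blast
    show "eigenvalue ?M (?ev (p div 2))"
      using p by (intro eigenvalue_mass_matrix[OF h p]) simp
    have "{L. L < p \<and> (L = p div 2 \<or> L = p - p div 2)} = {p div 2}" using p q by auto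
    then show "alg_multiplicity ?M (?ev (p div 2)) = 1" if "no_coincidence \<kappa> h p"
      using mult[OF that, of "p div 2"] by simp
    \<comment> \<open>The character of index p/2 has angle -pi j, which gives the alternating
      sign.\<close>
    have "cis (2 * pi * of_int (- int (p div 2)) * real j / real p) = (- 1) ^ j" for j
    proof -
      have "2 * pi * of_int (- int (p div 2)) * real j / real p = real j * (- pi)"
        using p by (simp add: q)
      then show ?thesis
        by (simp only: Complex.DeMoivre[symmetric]) (simp add: cis.code complex_eq_iff)
    qed
    then show "?ev (p div 2) = (\<Sum>j<p. (- 1) ^ j * of_real (F_M \<kappa> h (2 * real j / real p * pi)))"
      unfolding ev by (simp add: mult_ac)
    show "trapezoidal_approx p (\<lambda>x. of_real (F_M \<kappa> h x)) (p div 2) (?ev (p div 2))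
        (of_real (h * real p * integral {0..2 * pi} (\<lambda>t. Bessel_J p (2 * \<kappa> * h * sin t))))"
      using trapezoidal[of \<kappa> "p div 2"] that by simp
  qed
  show ?thesis
    using generating char_poly finite_not_no_coincidence[OF h, of _ p] zero double half by blast
qed

end
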